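(* Consider a min-plus linear system with service process $S(\tau,t)$, i.e., for any arrivals $A$ the departures are $D(t)=\inf_{\tau\in[0,t]}\{A(\tau)+S(\tau,t)\}$ for all $t\ge 0$, so that the lower bound $S(\tau,t)\ge D(t)-A(\tau)$ holds for all $\tau\in[0,t]$. Fix $t>0$ and define the minimal probe $$A_{mp}(\tau)=S(0,t)-S(\tau,t),\qquad \tau\in[0,t].$$ Then, for a probe $A$ and its departures $D$, the lower bound holds with equality, i.e., $S(\tau,t)=D(t)-A(\tau)$ for all $\tau\in[0,t]$, if and only if $A(\tau)=A_{mp}(\tau)$ for all $\tau\in[0,t]$.
   Context: The service process $S(\tau,t)$, $0\le\tau\le t$, is a non-negative real-valued function with $S(t,t)=0$ for all $t\ge 0$; no other property (additivity, stationarity) is assumed. Arrivals (probes) $A(t)$ denote cumulative arrivals in $(0,t]$, with $A(0)=0$; they are non-negative and non-decreasing. $D(t)$ denotes the cumulative departures corresponding to $A$. *)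

theory Defs
  imports Complex_Main
begin

text \<open>Time is continuous. Functions of time are total on \<^typ>\<open>real\<close>; only the values at
  times \<open>0 \<le> \<tau> \<le> t\<close> are constrained or used.\<close>

definition service_process :: "(real \<Rightarrow> real \<Rightarrow> real) \<Rightarrow> bool" where
  "service_process S \<longleftrightarrow>
     (\<forall>\<tau> t. 0 \<le> \<tau> \<and> \<tau> \<le> t \<longrightarrow> 0 \<le> S \<tau> t) \<and> (\<forall>t\<ge>0. S t t = 0)"

definition arrivals :: "(real \<Rightarrow> real) \<Rightarrow> bool" where
  "arrivals A \<longleftrightarrow> A 0 = 0 \<and> (\<forall>t\<ge>0. 0 \<le> A t) \<and> mono_on {0..} A"

text \<open>A system maps arrival functions to departure functions. For arrivals and a service process,
  the infimum below is over a nonempty set of reals bounded below by 0, so it is the genuine one.\<close>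

definition min_plus_linear_system ::
    "(real \<Rightarrow> real \<Rightarrow> real) \<Rightarrow> ((real \<Rightarrow> real) \<Rightarrow> (real \<Rightarrow> real)) \<Rightarrow> bool" where
  "min_plus_linear_system S Sys \<longleftrightarrow>
     service_process S \<and>
     (\<forall>A. arrivals A \<longrightarrow> (\<forall>t\<ge>0. Sys A t = (INF \<tau>\<in>{0..t}. A \<tau> + S \<tau> t)))"

definition minimal_probe :: "(real \<Rightarrow> real \<Rightarrow> real) \<Rightarrow> real \<Rightarrow> real \<Rightarrow> real" where
  "minimal_probe S t \<tau> = S 0 t - S \<tau> t"

end

theory Submission
  imports Defs
begin

text \<open>\<open>D t\<close> is the infimum of the sums \<open>A \<tau> + S \<tau> t\<close>,
  hence at most each of them; this is the lower bound. Equality throughout means that the sum does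
  not depend on \<tau>, its common value being \<open>D t\<close>. Since \<open>A 0 = 0\<close>, the
  time 0 identifies this value as \<open>S 0 t\<close>, and solving for \<open>A \<tau>\<close>
  gives the minimal probe. Conversely, the minimal probe makes the sum constantly
  \<open>S 0 t\<close>, so the infimum is that constant.\<close>

theorem lemma3:
  fixes S :: "real \<Rightarrow> real \<Rightarrow> real"
    and Sys :: "(real \<Rightarrow> real) \<Rightarrow> (real \<Rightarrow> real)"
    and A D :: "real \<Rightarrow> real"
    and t :: real
  assumes "min_plus_linear_system S Sys"
    and "t > 0"
    and "arrivals A"
    and "D = Sys A"
  shows "(\<forall>\<tau>\<in>{0..t}. S \<tau> t \<ge> D t - A \<tau>) \<and>
    ((\<forall>\<tau>\<in>{0..t}. S \<tau> t = D t - A \<tau>) \<longleftrightarrow> (\<forall>\<tau>\<in>{0..t}. A \<tau> = minimal_probe S t \<tau>))"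
proof -
  have D_eq: "D t = (INF \<tau>\<in>{0..t}. A \<tau> + S \<tau> t)"
    using assms(1,3) \<open>t > 0\<close> unfolding min_plus_linear_system_def \<open>D = Sys A\<close> by (meson less_imp_le)
  have S_nonneg: "0 \<le> S \<tau> t" if "\<tau> \<in> {0..t}" for \<tau>
    using assms(1) that by (auto simp: min_plus_linear_system_def service_process_def)
  have A_0: "A 0 = 0"
    using \<open>arrivals A\<close> by (simp add: arrivals_def)
  have A_nonneg: "0 \<le> A \<tau>" if "\<tau> \<in> {0..t}" for \<tau>
    using \<open>arrivals A\<close> that by (auto simp: arrivals_def)
  have zero_in: "0 \<in> {0..t}"
    using \<open>t > 0\<close> by simp
  \<comment> \<open>The reals are only conditionally complete, so \<open>cINF_lower\<close> needs
    this bound; 0 works because both summands are nonnegative.\<close>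
  have "bdd_below ((\<lambda>\<tau>. A \<tau> + S \<tau> t) ` {0..t})"
    using A_nonneg S_nonneg by (intro bdd_belowI2[of _ 0] add_nonneg_nonneg)
  then have lower: "D t \<le> A \<tau> + S \<tau> t" if "\<tau> \<in> {0..t}" for \<tau>
    unfolding D_eq using that by (rule cINF_lower)
  have "(\<forall>\<tau>\<in>{0..t}. S \<tau> t = D t - A \<tau>) \<longleftrightarrow> (\<forall>\<tau>\<in>{0..t}. A \<tau> = minimal_probe S t \<tau>)"
  proof
    assume eq: "\<forall>\<tau>\<in>{0..t}. S \<tau> t = D t - A \<tau>"
    \<comment> \<open>Equality at time 0, where the probe vanishes, already fixes
      \<open>D t\<close>.\<close>
    have "D t = S 0 t"
      using bspec[OF eq zero_in] A_0 by simp
    show "\<forall>\<tau>\<in>{0..t}. A \<tau> = minimal_probe S t \<tau>"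
    proof
      fix \<tau> assume "\<tau> \<in> {0..t}"
      from bspec[OF eq this] \<open>D t = S 0 t\<close> show "A \<tau> = minimal_probe S t \<tau>"
        unfolding minimal_probe_def by linarith
    qed
  next
    assume eq: "\<forall>\<tau>\<in>{0..t}. A \<tau> = minimal_probe S t \<tau>"
    \<comment> \<open>The probe cancels \<open>S \<tau> t\<close> in each sum, leaving a constant
      family.\<close>
    have "D t = (INF \<tau>\<in>{0..t}. S 0 t)"
      unfolding D_eq using eq
      by (intro arg_cong[where f = Inf] image_cong) (simp_all add: minimal_probe_def)
    \<comment> \<open>An infimum of a constant is that constant only over a nonempty index set,
      hence the use of \<open>t > 0\<close>.\<close>
    then have "D t = S 0 t"
      using \<open>t > 0\<close> by simp
    then show "\<forall>\<tau>\<in>{0..t}. S \<tau> t = D t - A \<tau>"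
      using eq by (simp add: minimal_probe_def)
  qed
  moreover have "\<forall>\<tau>\<in>{0..t}. S \<tau> t \<ge> D t - A \<tau>"
    using lower by (simp add: diff_le_eq add.commute)
  ultimately show ?thesis
    by blast
qed

end
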